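(* Let $P$ be a finite poset with minimum element $\hat{0}$, let $\rho:P\to\mathbb{N}$ be any function, and let $m\in\mathbb{N}$ with $\rho(P):=\max_{x\in P}\rho(x)\le m$. Let $(S_1,\dots,S_n)$ be an ordered collection of subsets of $P$, each containing $\hat{0}$, and let $f:\prod_{i=1}^n RT_{S_i}\to P$ be a transversal function. Suppose: (1) if $x\le y$ in $P$ and $\mathbf{s}\in\mathcal{T}_x$, then there exists $\mathbf{t}\in\mathcal{T}_y$ with $\mathbf{s}\le\mathbf{t}$; (2) if $\mathbf{t}\in\mathcal{T}_x^a$, then $|\operatorname{supp}\mathbf{t}|=\rho(x)$; (3) the summation condition holds for every class $\mathcal{T}_x$, i.e. for every $x\neq\hat{0}$, $\sum_{\mathbf{s}\in L(\mathcal{T}_x)}\mu(\mathbf{s})=0$, where $L(\mathcal{T}_x)$ is the lower order ideal of $\prod_i RT_{S_i}$ generated by $\mathcal{T}_x$ and $\mu$ is the Möbius function of $\prod_i RT_{S_i}$. Then: (a) $P\cong\left(\prod_{i=1}^n RT_{S_i}\right)/\ker f$; (b) for each $x\in P$, $\mu(x)=(-1)^{\rho(x)}|\mathcal{T}_x^a|$; (c) $\chi(P,t)=t^{m-n}\prod_{i=1}^n\bigl(t-|A(RT_{S_i})|\bigr)$, where $A(RT_{S_i})$ is the set of atoms of $RT_{S_i}$.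
   Context: All posets are finite with a minimum element $\hat{0}$. The Möbius function of such a poset $Q$ is the unique $\mu:Q\to\mathbb{Z}$ with $\sum_{y\le x}\mu(y)=\delta_{\hat{0},x}$ for all $x$ (i.e. $\mu(x)=\mu(\hat 0,x)$). For $\rho:P\to\mathbb{N}$ and $m\ge\rho(P)$, the characteristic polynomial of $P$ with respect to $\rho$ and $m$ is $\chi(P,t)=\sum_{x\in P}\mu(x)t^{m-\rho(x)}$. For $S\subseteq P$ with $\hat{0}\in S$, the rooted tree $RT_S$ is the set of saturated chains of $P$ that start at $\hat{0}$ and use only elements of $S$, ordered by containment; its minimum is the one-element chain $\hat 0$, and an element of $RT_S$ is often identified with the top element of the chain. Elements of $\prod_i RT_{S_i}$ (ordered componentwise) are written $\mathbf{t}=(t_1,\dots,t_n)$. A transversal function is a map $f:\prod_{i=1}^nRT_{S_i}\to P$ that is order preserving, surjective, and such that $f(\mathbf{t})=\hat{0}$ implies $t_i=\hat{0}$ for all $i$. Its kernel $\ker f$ is the equivalence relation $\mathbf{s}\sim\mathbf{t}\iff f(\mathbf{s})=f(\mathbf{t})$. $\mathcal{T}_x=f^{-1}(x)$ is the set of transversals for $x$; $\mathbf{t}$ is atomic if each $t_i$ is either $\hat{0}$ or an atom of $RT_{S_i}$; $\mathcal{T}_x^a$ is the set of atomic transversals for $x$; $\operatorname{supp}\mathbf{t}=\{i:t_i\ne\hat{0}\}$. For an equivalence relation $\sim$ on a poset $Q$, the quotient $Q/\sim$ is the set of classes with $X\le Y$ iff $x\le y$ for some $x\in X$, $y\in Y$.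 *)

theory Defs
  imports "HOL-Library.FuncSet" "HOL-Computational_Algebra.Computational_Algebra"
begin

text \<open>
  A poset is represented by its reflexive order relation \<open>r\<close>, with carrier \<open>Field r\<close>;
  \<open>(x, y) \<in> r\<close> means \<open>x \<le> y\<close>.
\<close>

subsection \<open>Finite posets with a minimum\<close>

definition is_min :: "'a rel \<Rightarrow> 'a \<Rightarrow> bool" where
  "is_min r z \<longleftrightarrow> z \<in> Field r \<and> (\<forall>x\<in>Field r. (z, x) \<in> r)"

definition finite_poset_with_min :: "'a rel \<Rightarrow> bool" where
  "finite_poset_with_min r \<longleftrightarrow>
     finite (Field r) \<and> Partial_order r \<and> (\<exists>z. is_min r z)"

definition min_elt :: "'a rel \<Rightarrow> 'a" where
  "min_elt r = (THE z. is_min r z)"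

definition covers :: "'a rel \<Rightarrow> 'a \<Rightarrow> 'a \<Rightarrow> bool" where
  "covers r x y \<longleftrightarrow>
     (x, y) \<in> r \<and> x \<noteq> y \<and> \<not> (\<exists>z. (x, z) \<in> r \<and> (z, y) \<in> r \<and> z \<noteq> x \<and> z \<noteq> y)"

definition atoms :: "'a rel \<Rightarrow> 'a set" where
  "atoms r = {a. covers r (min_elt r) a}"

definition lower_ideal :: "'a rel \<Rightarrow> 'a set \<Rightarrow> 'a set" where
  "lower_ideal r X = {s \<in> Field r. \<exists>t\<in>X. (s, t) \<in> r}"

definition order_isomorphic :: "'a rel \<Rightarrow> 'b rel \<Rightarrow> bool" where
  "order_isomorphic r s \<longleftrightarrow>
     (\<exists>\<phi>. bij_betw \<phi> (Field r) (Field s) \<and>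
          (\<forall>x\<in>Field r. \<forall>y\<in>Field r. (x, y) \<in> r \<longleftrightarrow> (\<phi> x, \<phi> y) \<in> s))"

definition quotient_order :: "'a rel \<Rightarrow> 'a rel \<Rightarrow> 'a set rel" where
  "quotient_order r E =
     {(X, Y). X \<in> Field r // E \<and> Y \<in> Field r // E \<and> (\<exists>x\<in>X. \<exists>y\<in>Y. (x, y) \<in> r)}"

definition prod_order :: "'i set \<Rightarrow> ('i \<Rightarrow> 'a rel) \<Rightarrow> ('i \<Rightarrow> 'a) rel" where
  "prod_order I R =
     {(s, t). s \<in> (\<Pi>\<^sub>E i\<in>I. Field (R i)) \<and> t \<in> (\<Pi>\<^sub>E i\<in>I. Field (R i)) \<and>
              (\<forall>i\<in>I. (s i, t i) \<in> R i)}"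

subsection \<open>Moebius function and characteristic polynomial\<close>

text \<open>
  The value \<open>0\<close> outside the carrier only makes the function unique as a total function.
\<close>

definition is_mobius :: "'a rel \<Rightarrow> ('a \<Rightarrow> int) \<Rightarrow> bool" where
  "is_mobius r \<mu> \<longleftrightarrow>
     (\<forall>x\<in>Field r. (\<Sum>y\<in>under r x. \<mu> y) = (if x = min_elt r then 1 else 0)) \<and>
     (\<forall>x. x \<notin> Field r \<longrightarrow> \<mu> x = 0)"

definition mobius :: "'a rel \<Rightarrow> 'a \<Rightarrow> int" where
  "mobius r = (THE \<mu>. is_mobius r \<mu>)"

definition characteristic_poly :: "'a rel \<Rightarrow> ('a \<Rightarrow> nat) \<Rightarrow> nat \<Rightarrow> int poly" where
  "characteristic_poly r \<rho> m = (\<Sum>x\<in>Field r. monom (mobius r x) (m - \<rho> x))"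

text \<open>
  The embedding of \<open>\<int>[t]\<close> into its field of fractions, needed to make sense of
  \<open>t\<close> raised to a negative power.
\<close>

definition ratfun :: "int poly \<Rightarrow> int poly fract" where
  "ratfun p = Fraction_Field.Fract p 1"

subsection \<open>Rooted trees and transversal functions\<close>

text \<open>
  A chain is identified with its set of elements; being saturated refers to the cover
  relation of the whole poset \<open>r\<close>, not of its restriction to \<open>S\<close>.
\<close>

definition root_chains :: "'a rel \<Rightarrow> 'a set \<Rightarrow> 'a set set" where
  "root_chains r S =
     {set xs |xs. xs \<noteq> [] \<and> hd xs = min_elt r \<and> set xs \<subseteq> S \<and> successively (covers r) xs}"

definition rooted_tree :: "'a rel \<Rightarrow> 'a set \<Rightarrow> 'a set rel" where
  "rooted_tree r S = {(C, D). C \<in> root_chains r S \<and> D \<in> root_chains r S \<and> C \<subseteq> D}"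

definition tree_prod :: "'a rel \<Rightarrow> nat \<Rightarrow> (nat \<Rightarrow> 'a set) \<Rightarrow> (nat \<Rightarrow> 'a set) rel" where
  "tree_prod r n S = prod_order {1..n} (\<lambda>i. rooted_tree r (S i))"

definition transversal_function ::
    "'a rel \<Rightarrow> nat \<Rightarrow> (nat \<Rightarrow> 'a set) \<Rightarrow> ((nat \<Rightarrow> 'a set) \<Rightarrow> 'a) \<Rightarrow> bool" where
  "transversal_function r n S f \<longleftrightarrow>
     f ` Field (tree_prod r n S) = Field r \<and>
     (\<forall>s t. (s, t) \<in> tree_prod r n S \<longrightarrow> (f s, f t) \<in> r) \<and>
     (\<forall>t\<in>Field (tree_prod r n S). f t = min_elt r \<longrightarrow>
        (\<forall>i\<in>{1..n}. t i = min_elt (rooted_tree r (S i))))"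

definition ker_on :: "'b set \<Rightarrow> ('b \<Rightarrow> 'a) \<Rightarrow> 'b rel" where
  "ker_on A f = {(s, t). s \<in> A \<and> t \<in> A \<and> f s = f t}"

definition transversals ::
    "'a rel \<Rightarrow> nat \<Rightarrow> (nat \<Rightarrow> 'a set) \<Rightarrow> ((nat \<Rightarrow> 'a set) \<Rightarrow> 'a) \<Rightarrow> 'a \<Rightarrow> (nat \<Rightarrow> 'a set) set" where
  "transversals r n S f x = {t \<in> Field (tree_prod r n S). f t = x}"

definition atomic :: "'a rel \<Rightarrow> nat \<Rightarrow> (nat \<Rightarrow> 'a set) \<Rightarrow> (nat \<Rightarrow> 'a set) \<Rightarrow> bool" where
  "atomic r n S t \<longleftrightarrow>
     (\<forall>i\<in>{1..n}. t i = min_elt (rooted_tree r (S i)) \<or> t i \<in> atoms (rooted_tree r (S i)))"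

definition atomic_transversals ::
    "'a rel \<Rightarrow> nat \<Rightarrow> (nat \<Rightarrow> 'a set) \<Rightarrow> ((nat \<Rightarrow> 'a set) \<Rightarrow> 'a) \<Rightarrow> 'a \<Rightarrow> (nat \<Rightarrow> 'a set) set" where
  "atomic_transversals r n S f x = {t \<in> transversals r n S f x. atomic r n S t}"

definition tsupp :: "'a rel \<Rightarrow> nat \<Rightarrow> (nat \<Rightarrow> 'a set) \<Rightarrow> (nat \<Rightarrow> 'a set) \<Rightarrow> nat set" where
  "tsupp r n S t = {i \<in> {1..n}. t i \<noteq> min_elt (rooted_tree r (S i))}"

subsection \<open>Well-definedness\<close>

lemma min_elt_eq:
  assumes "Partial_order r" "is_min r z"
  shows "min_elt r = z"
  unfolding min_elt_def
  using assms by (intro the_equality) (auto simp: is_min_def partial_order_on_def antisym_def)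

lemma is_min_min_elt:
  assumes "finite_poset_with_min r"
  shows "is_min r (min_elt r)"
  using assms min_elt_eq unfolding finite_poset_with_min_def by metis

lemma mobius_exists_unique:
  assumes "finite_poset_with_min r"
  shows "\<exists>!\<mu>. is_mobius r \<mu>"
proof -
  from assms have fin: "finite (Field r)" and po: "Partial_order r"
    by (auto simp: finite_poset_with_min_def)
  have "finite r"
    using fin finite_subset[of r "Field r \<times> Field r"] partial_order_onD(4)[OF po] by blast
  then have wf: "wf (r - Id)" using po by (rule partial_order_on_well_order_on)
  have under: "under r x = insert x (underS r x)" "x \<notin> underS r x" "finite (underS r x)"
    if "x \<in> Field r" for x
  proof -
    show "under r x = insert x (underS r x)"
      using Refl_under_underS[OF partial_order_onD(1)[OF po] that] by blast
    show "x \<notin> underS r x" by (simp add: underS_def)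
    show "finite (underS r x)"
      using fin under_Field underS_subset_under by (metis finite_subset)
  qed
  define H where "H = (\<lambda>\<mu> x. if x \<in> Field r
      then (if x = min_elt r then 1 else 0) - (\<Sum>y\<in>underS r x. \<mu> y) else (0::int))"
  have iff: "is_mobius r \<mu> \<longleftrightarrow> (\<forall>x. \<mu> x = H \<mu> x)" for \<mu>
    unfolding is_mobius_def H_def using under by (auto simp: algebra_simps)
  have cong: "H \<mu> x = H \<nu> x" if "\<And>y. (y, x) \<in> r - Id \<Longrightarrow> \<mu> y = \<nu> y" for \<mu> \<nu> x
    unfolding H_def using that by (auto intro!: sum.cong simp: underS_def)
  have adm: "adm_wf (r - Id) H" unfolding adm_wf_def using cong by blast
  show ?thesis
  proof (rule ex1I)
    show "is_mobius r (wfrec (r - Id) H)"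
      unfolding iff using wfrec_fixpoint[OF wf adm] by metis
  next
    fix \<nu> assume "is_mobius r \<nu>"
    then have \<nu>: "\<nu> x = H \<nu> x" for x by (simp add: iff)
    have "\<nu> x = wfrec (r - Id) H x" for x
      using wf
    proof (induction x)
      case (less x)
      then have "H \<nu> x = H (wfrec (r - Id) H) x" by (intro cong) auto
      then show ?case using \<nu> wfrec_fixpoint[OF wf adm] by metis
    qed
    then show "\<nu> = wfrec (r - Id) H" by auto
  qed
qed

corollary is_mobius_mobius:
  assumes "finite_poset_with_min r"
  shows "is_mobius r (mobius r)"
  unfolding mobius_def by (rule theI'[OF mobius_exists_unique[OF assms]])

lemma Field_rooted_tree: "Field (rooted_tree r S) = root_chains r S"
  by (auto simp: Field_def rooted_tree_def)

lemma rooted_tree_poset: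
  assumes "finite_poset_with_min r" "S \<subseteq> Field r" "min_elt r \<in> S"
  shows "finite_poset_with_min (rooted_tree r S)"
    and "min_elt (rooted_tree r S) = {min_elt r}"
proof -
  have po: "Partial_order (rooted_tree r S)"
    unfolding Field_rooted_tree partial_order_on_def preorder_on_def
    by (auto simp: rooted_tree_def refl_on_def trans_def antisym_def)
  have "finite S" using assms finite_subset by (auto simp: finite_poset_with_min_def)
  moreover have "root_chains r S \<subseteq> Pow S" by (auto simp: root_chains_def)
  ultimately have fin: "finite (root_chains r S)" by (meson finite_Pow_iff finite_subset)
  have "{min_elt r} \<in> root_chains r S"
    unfolding root_chains_def using assms by (intro CollectI exI[of _ "[min_elt r]"]) auto
  moreover have "min_elt r \<in> C" if "C \<in> root_chains r S" for C
    using that hd_in_set by (fastforce simp: root_chains_def)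
  ultimately have min: "is_min (rooted_tree r S) {min_elt r}"
    unfolding is_min_def Field_rooted_tree by (auto simp: rooted_tree_def)
  show "finite_poset_with_min (rooted_tree r S)"
    unfolding finite_poset_with_min_def using po fin min by (auto simp: Field_rooted_tree)
  show "min_elt (rooted_tree r S) = {min_elt r}" by (rule min_elt_eq[OF po min])
qed

lemma Field_prod_order:
  assumes "\<And>i. i \<in> I \<Longrightarrow> Partial_order (R i)"
  shows "Field (prod_order I R) = (\<Pi>\<^sub>E i\<in>I. Field (R i))"
proof -
  have "(s, s) \<in> prod_order I R" if "s \<in> (\<Pi>\<^sub>E i\<in>I. Field (R i))" for s
    using that assms by (auto simp: prod_order_def partial_order_on_def preorder_on_def
        refl_on_def PiE_mem)
  then show ?thesis by (auto simp: Field_def prod_order_def)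
qed

lemma prod_order_poset:
  assumes "finite I" "\<And>i. i \<in> I \<Longrightarrow> finite_poset_with_min (R i)"
  shows "finite_poset_with_min (prod_order I R)"
    and "min_elt (prod_order I R) = (\<lambda>i\<in>I. min_elt (R i))"
proof -
  have R: "Partial_order (R i)" "finite (Field (R i))" "is_min (R i) (min_elt (R i))"
    if "i \<in> I" for i
    using assms(2)[OF that] is_min_min_elt by (auto simp: finite_poset_with_min_def)
  have F: "Field (prod_order I R) = (\<Pi>\<^sub>E i\<in>I. Field (R i))"
    using R(1) by (rule Field_prod_order)
  have fin: "finite (Field (prod_order I R))"
    unfolding F using assms(1) R(2) by (intro finite_PiE) auto
  have "refl_on (Field (prod_order I R)) (prod_order I R)"
    unfolding F using R(1)
    by (auto simp: refl_on_def prod_order_def partial_order_on_def preorder_on_def PiE_mem)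
  moreover have "trans (prod_order I R)"
    using partial_order_onD(2)[OF R(1)] by (fastforce simp: trans_def prod_order_def)
  moreover have "antisym (prod_order I R)"
  proof (rule antisymI)
    fix s t assume st: "(s, t) \<in> prod_order I R" "(t, s) \<in> prod_order I R"
    have "s i = t i" if "i \<in> I" for i
      using st that partial_order_onD(3)[OF R(1)[OF that]]
      by (auto simp: prod_order_def dest: antisymD)
    then show "s = t" using st by (auto simp: prod_order_def intro: PiE_ext)
  qed
  moreover have "prod_order I R \<subseteq> Field (prod_order I R) \<times> Field (prod_order I R)"
    by (auto simp: Field_def)
  ultimately have po: "Partial_order (prod_order I R)"
    by (simp add: partial_order_on_def preorder_on_def)
  have min: "is_min (prod_order I R) (\<lambda>i\<in>I. min_elt (R i))"
    unfolding is_min_def F using R(3) by (auto simp: prod_order_def is_min_def PiE_mem)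
  show "finite_poset_with_min (prod_order I R)"
    using fin po min by (auto simp: finite_poset_with_min_def)
  show "min_elt (prod_order I R) = (\<lambda>i\<in>I. min_elt (R i))" by (rule min_elt_eq[OF po min])
qed

end

(*
  Summing the Moebius function of the product of rooted trees over the fibres of f gives the
  Moebius function of P: by lifting, the lower ideal generated by the transversals for x is the
  union of the fibres over the elements below x, so the summation condition is the defining
  recursion.  In a rooted tree every element other than the root lies above exactly one atom,
  hence the Moebius function is 1 at the root, -1 at atoms and 0 elsewhere; on the product it
  equals (-1)^|supp t| at atomic t and vanishes elsewhere.  The characteristic polynomial then
  becomes a sum of products, which factors.
*)
theory Submission
  imports Defs
begin

section \<open>Moebius functions\<close>

lemma mobius_eqI:
  assumes "finite_poset_with_min r" "is_mobius r \<mu>"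
  shows "mobius r = \<mu>"
  using mobius_exists_unique[OF assms(1)] is_mobius_mobius[OF assms(1)] assms(2) by blast

lemma min_elt_in_Field: "finite_poset_with_min r \<Longrightarrow> min_elt r \<in> Field r"
  using is_min_min_elt unfolding is_min_def by blast

lemma min_elt_le: "finite_poset_with_min r \<Longrightarrow> x \<in> Field r \<Longrightarrow> (min_elt r, x) \<in> r"
  using is_min_min_elt unfolding is_min_def by blast

lemma finite_poset_with_min_antisym:
  "finite_poset_with_min r \<Longrightarrow> (x, y) \<in> r \<Longrightarrow> (y, x) \<in> r \<Longrightarrow> x = y"
  by (auto simp: finite_poset_with_min_def partial_order_on_def dest: antisymD)

lemma finite_poset_with_min_trans:
  "finite_poset_with_min r \<Longrightarrow> (x, y) \<in> r \<Longrightarrow> (y, z) \<in> r \<Longrightarrow> (x, z) \<in> r"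
  by (auto simp: finite_poset_with_min_def partial_order_on_def preorder_on_def dest: transD)

lemma finite_poset_with_min_refl:
  "finite_poset_with_min r \<Longrightarrow> x \<in> Field r \<Longrightarrow> (x, x) \<in> r"
  by (auto simp: finite_poset_with_min_def partial_order_on_def preorder_on_def refl_on_def)

lemma finite_under:
  assumes "finite_poset_with_min r"
  shows "finite (under r x)"
  using assms finite_subset[OF under_Field[of r x]] by (simp add: finite_poset_with_min_def)

lemma under_min_elt:
  assumes "finite_poset_with_min r"
  shows "under r (min_elt r) = {min_elt r}"
proof -
  have "y = min_elt r" if "(y, min_elt r) \<in> r" for y
    using finite_poset_with_min_antisym[OF assms that] min_elt_le[OF assms, of y] that
    by (auto simp: Field_def)
  then show ?thesis
    using finite_poset_with_min_refl[OF assms min_elt_in_Field[OF assms]]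
    by (auto simp: under_def)
qed

lemma atoms_subset_Field: "atoms r \<subseteq> Field r"
  by (auto simp: atoms_def covers_def Field_def)

lemma min_elt_notin_atoms: "min_elt r \<notin> atoms r"
  by (auto simp: atoms_def covers_def)

text \<open>Below a non-minimal \<open>x\<close> the candidate is nonzero only at the minimum and at
  the one atom under \<open>x\<close>, where the values 1 and -1 cancel. Uniqueness of the Moebius
  function does the rest.\<close>

lemma mobius_unique_atom_below:
  assumes r: "finite_poset_with_min r"
    and atom: "\<And>x. x \<in> Field r \<Longrightarrow> x \<noteq> min_elt r \<Longrightarrow> \<exists>!a. a \<in> atoms r \<and> (a, x) \<in> r"
  shows "mobius r x = (if x = min_elt r then 1 else if x \<in> atoms r then - 1 else 0)"
proof -
  define \<mu> where "\<mu> = (\<lambda>x. if x = min_elt r then 1 else if x \<in> atoms r then - 1 else (0::int))"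
  have "(\<Sum>y\<in>under r x. \<mu> y) = 0" if x: "x \<in> Field r" "x \<noteq> min_elt r" for x
  proof -
    obtain a where ax: "a \<in> atoms r \<and> (a, x) \<in> r"
      and uniq: "\<forall>b. b \<in> atoms r \<and> (b, x) \<in> r \<longrightarrow> b = a"
      using atom[OF x] by (rule ex1E)
    from ax have a: "a \<in> atoms r" "(a, x) \<in> r" by simp_all
    have ne: "a \<noteq> min_elt r" using a min_elt_notin_atoms by metis
    have "(\<Sum>y\<in>under r x. \<mu> y) = (\<Sum>y\<in>{min_elt r, a}. \<mu> y)"
    proof (intro sum.mono_neutral_right finite_under[OF r] ballI)
      show "{min_elt r, a} \<subseteq> under r x"
        using a(2) min_elt_le[OF r x(1)] by (simp add: under_def)
      show "\<mu> y = 0" if "y \<in> under r x - {min_elt r, a}" for y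
      proof -
        have "y \<notin> atoms r" using that uniq unfolding under_def by blast
        then show ?thesis using that by (simp add: \<mu>_def)
      qed
    qed
    also have "\<dots> = 0" using ne a(1) by (simp add: \<mu>_def)
    finally show ?thesis .
  qed
  moreover have "(\<Sum>y\<in>under r (min_elt r). \<mu> y) = 1"
    by (simp add: under_min_elt[OF r] \<mu>_def)
  \<comment> \<open>\<open>is_mobius\<close> also prescribes the value 0 off the carrier; the
    minimum and the atoms lie inside it.\<close>
  moreover have "\<mu> x = 0" if "x \<notin> Field r" for x
    using that min_elt_in_Field[OF r] atoms_subset_Field[of r] by (auto simp: \<mu>_def)
  ultimately have "is_mobius r \<mu>" by (auto simp: is_mobius_def)
  from mobius_eqI[OF r this] show ?thesis by (simp add: \<mu>_def)
qed

text \<open>A principal ideal of the product is the product of the principal ideals of the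
  coordinates. By distributivity the defining sum therefore factors into the defining sums of the
  \<open>R i\<close>.\<close>

lemma mobius_prod_order:
  assumes I: "finite I" and R: "\<And>i. i \<in> I \<Longrightarrow> finite_poset_with_min (R i)"
    and t: "t \<in> Field (prod_order I R)"
  shows "mobius (prod_order I R) t = (\<Prod>i\<in>I. mobius (R i) (t i))"
proof -
  let ?Q = "prod_order I R"
  \<comment> \<open>The bare product sees \<open>t\<close> only on \<open>I\<close>, so it can be
    nonzero at functions that are not extensional; the case split forces the required 0
    there.\<close>
  define \<mu> where "\<mu> = (\<lambda>t. if t \<in> Field ?Q then \<Prod>i\<in>I. mobius (R i) (t i) else 0)"
  have Q: "finite_poset_with_min ?Q" "min_elt ?Q = (\<lambda>i\<in>I. min_elt (R i))"
    using I R by (auto intro: prod_order_poset)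
  have F: "Field ?Q = (\<Pi>\<^sub>E i\<in>I. Field (R i))"
    using R by (intro Field_prod_order) (auto simp: finite_poset_with_min_def)
  have under: "under ?Q t = (\<Pi>\<^sub>E i\<in>I. under (R i) (t i))" if "t \<in> Field ?Q" for t
  proof (rule set_eqI)
    fix s
    from that have t: "t \<in> (\<Pi>\<^sub>E i\<in>I. Field (R i))" by (simp only: F)
    have "s \<in> (\<Pi>\<^sub>E i\<in>I. under (R i) (t i)) \<longleftrightarrow>
        s \<in> (\<Pi>\<^sub>E i\<in>I. Field (R i)) \<and> (\<forall>i\<in>I. (s i, t i) \<in> R i)"
      unfolding PiE_iff by (auto simp: under_def intro: FieldI1)
    with t show "s \<in> under ?Q t \<longleftrightarrow> s \<in> (\<Pi>\<^sub>E i\<in>I. under (R i) (t i))"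
      by (simp add: under_def prod_order_def)
  qed
  have "(\<Sum>s\<in>under ?Q t. \<mu> s) = (if t = min_elt ?Q then 1 else 0)" if t: "t \<in> Field ?Q" for t
  proof -
    have "(\<Sum>s\<in>under ?Q t. \<mu> s) = (\<Sum>s\<in>under ?Q t. \<Prod>i\<in>I. mobius (R i) (s i))"
      using under_Field[of ?Q t] by (intro sum.cong) (auto simp: \<mu>_def)
    also have "\<dots> = (\<Prod>i\<in>I. \<Sum>y\<in>under (R i) (t i). mobius (R i) y)"
      unfolding under[OF t] using I finite_under[OF R]
      by (subst prod_sum_PiE) auto
    also have "\<dots> = (\<Prod>i\<in>I. if t i = min_elt (R i) then 1 else 0)"
      using t is_mobius_mobius[OF R] unfolding F
      by (intro prod.cong) (auto simp: is_mobius_def PiE_iff)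
    also have "\<dots> = (if \<forall>i\<in>I. t i = min_elt (R i) then 1 else 0)"
      using I by (auto intro: prod.neutral prod_zero)
    also have "(\<forall>i\<in>I. t i = min_elt (R i)) \<longleftrightarrow> t = min_elt ?Q"
      using t unfolding F Q(2) by (auto simp: PiE_iff extensional_def fun_eq_iff)
    finally show ?thesis .
  qed
  then have "is_mobius ?Q \<mu>" by (auto simp: is_mobius_def \<mu>_def)
  from mobius_eqI[OF Q(1) this] t show ?thesis by (simp add: \<mu>_def)
qed

section \<open>Rooted trees\<close>

text \<open>Serves to compare the second element of a rooted chain with all later ones.\<close>

lemma successively_covers_le:
  assumes r: "finite_poset_with_min r"
  shows "successively (covers r) (x # xs) \<Longrightarrow> y \<in> set xs \<Longrightarrow> (x, y) \<in> r"
proof (induction xs arbitrary: x)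
  case (Cons z zs)
  then have "(x, z) \<in> r" and "y = z \<or> (z, y) \<in> r" by (auto simp: covers_def)
  then show ?case using finite_poset_with_min_trans[OF r] by blast
qed simp

text \<open>Recovers from the set encoding a list of covers, so that the second element of a
  nontrivial chain, an atom of \<open>r\<close>, becomes available.\<close>

lemma root_chainE:
  assumes C: "C \<in> root_chains r S" and ne: "C \<noteq> {min_elt r}"
  obtains a xs where "C = insert (min_elt r) (insert a (set xs))"
    "covers r (min_elt r) a" "successively (covers r) (a # xs)" "C \<subseteq> S"
proof -
  from C obtain ys where ys: "C = set ys" "ys \<noteq> []" "hd ys = min_elt r" "set ys \<subseteq> S"
    "successively (covers r) ys" by (auto simp: root_chains_def)
  then obtain zs where zs: "ys = min_elt r # zs" by (metis list.collapse)
  with ne ys(1) have "zs \<noteq> []" by auto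
  then obtain a xs where a: "zs = a # xs" by (metis list.exhaust)
  show ?thesis
  proof (rule that[of a xs])
    show "C = insert (min_elt r) (insert a (set xs))" by (simp add: ys(1) zs a)
    show "covers r (min_elt r) a" "successively (covers r) (a # xs)"
      using ys(5) by (simp_all add: zs a)
    show "C \<subseteq> S" using ys(1,4) by simp
  qed
qed

text \<open>The atom is the two-element initial segment of \<open>C\<close>, consisting of the
  minimum and the second element \<open>a\<close>.\<close>

lemma unique_atom_below_rooted_tree:
  assumes r: "finite_poset_with_min r" and S: "S \<subseteq> Field r" "min_elt r \<in> S"
    and C: "C \<in> Field (rooted_tree r S)" and ne: "C \<noteq> min_elt (rooted_tree r S)"
  shows "\<exists>!A. A \<in> atoms (rooted_tree r S) \<and> (A, C) \<in> rooted_tree r S"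
proof -
  let ?z = "min_elt r" and ?T = "rooted_tree r S"
  note min = rooted_tree_poset(2)[OF r S]
  have C': "C \<in> root_chains r S" "C \<noteq> {?z}" using C ne by (auto simp: Field_rooted_tree min)
  then obtain a xs where Ceq: "C = insert ?z (insert a (set xs))" and a: "covers r ?z a"
      and xs: "successively (covers r) (a # xs)" and CS: "C \<subseteq> S" by (rule root_chainE)
  have za: "(?z, a) \<in> r" "?z \<noteq> a" using a by (auto simp: covers_def)
  \<comment> \<open>The second element \<open>b\<close> of \<open>D\<close> lies in
    \<open>C\<close>, hence at or above \<open>a\<close>. Since \<open>b\<close> covers the minimum
    and \<open>a\<close> is not the minimum, \<open>b = a\<close>.\<close>
  have low: "{?z, a} \<subseteq> D" if D: "D \<in> root_chains r S" "D \<noteq> {?z}" "D \<subseteq> C" for D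
  proof -
    obtain b ys where b: "D = insert ?z (insert b (set ys))" "covers r ?z b"
      using D(1,2) by (rule root_chainE)
    from b(1) D(3) have "b \<in> C" by blast
    moreover from b(2) have "b \<noteq> ?z" by (auto simp: covers_def)
    ultimately have "b = a \<or> b \<in> set xs" unfolding Ceq by simp
    then have "b = a"
    proof
      assume "b \<in> set xs"
      with successively_covers_le[OF r xs] have "(a, b) \<in> r" by blast
      with b(2) za show "b = a" unfolding covers_def by blast
    qed
    then show ?thesis unfolding b(1) by simp
  qed
  have A: "{?z, a} \<in> root_chains r S"
    unfolding root_chains_def using a CS Ceq
    by (intro CollectI exI[of _ "[?z, a]"]) auto
  have Z: "{?z} \<in> root_chains r S"
    using min_elt_in_Field[OF rooted_tree_poset(1)[OF r S]] by (simp add: min Field_rooted_tree)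
  have AC: "{?z, a} \<subseteq> C" using Ceq by auto
  show ?thesis
  proof (rule ex1I[of _ "{?z, a}"], intro conjI)
    show "{?z, a} \<in> atoms ?T"
      \<comment> \<open>A chain strictly between the root and \<open>{?z, a}\<close> would lie in
        \<open>C\<close>, and \<open>low\<close> makes it contain \<open>{?z, a}\<close>.\<close>
      unfolding atoms_def covers_def min using A Z za low AC
      by (auto simp: rooted_tree_def)
    show "({?z, a}, C) \<in> ?T" using A C' AC by (auto simp: rooted_tree_def)
  next
    fix B assume B: "B \<in> atoms ?T \<and> (B, C) \<in> ?T"
    then have B': "B \<in> root_chains r S" "B \<noteq> {?z}" "B \<subseteq> C"
      unfolding atoms_def covers_def min by (auto simp: rooted_tree_def)
    \<comment> \<open>\<open>{?z, a}\<close> is squeezed between the root and \<open>B\<close>; as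
      \<open>B\<close> covers the root, the two coincide.\<close>
    then have "({?z, a}, B) \<in> ?T" "({?z}, {?z, a}) \<in> ?T"
      using low A Z by (auto simp: rooted_tree_def)
    with B za show "B = {?z, a}" unfolding atoms_def covers_def min by auto
  qed
qed

lemma mobius_rooted_tree:
  assumes "finite_poset_with_min r" "S \<subseteq> Field r" "min_elt r \<in> S"
  shows "mobius (rooted_tree r S) C =
    (if C = min_elt (rooted_tree r S) then 1 else if C \<in> atoms (rooted_tree r S) then - 1 else 0)"
proof (rule mobius_unique_atom_below)
  show "finite_poset_with_min (rooted_tree r S)" using assms by (rule rooted_tree_poset(1))
  show "\<exists>!A. A \<in> atoms (rooted_tree r S) \<and> (A, D) \<in> rooted_tree r S"
    if "D \<in> Field (rooted_tree r S)" "D \<noteq> min_elt (rooted_tree r S)" for D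
    using assms that by (rule unique_atom_below_rooted_tree)
qed

text \<open>The linear factor contributed by one tree: the root gives \<open>X\<close>, each atom
  gives -1, and all other chains have Moebius value 0. \<open>X\<close> is later the polynomial
  variable.\<close>

lemma sum_mobius_rooted_tree:
  assumes "finite_poset_with_min r" "S \<subseteq> Field r" "min_elt r \<in> S"
  shows "(\<Sum>C\<in>Field (rooted_tree r S).
            of_int (mobius (rooted_tree r S) C) * (if C = min_elt (rooted_tree r S) then X else 1))
         = (X :: 'b :: comm_ring_1) - of_nat (card (atoms (rooted_tree r S)))"
proof -
  let ?T = "rooted_tree r S"
  note T = rooted_tree_poset(1)[OF assms]
  have fin: "finite (Field ?T)" using T by (simp add: finite_poset_with_min_def)
  then have fina: "finite (atoms ?T)" by (rule finite_subset[OF atoms_subset_Field])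
  have "(\<Sum>C\<in>Field ?T. of_int (mobius ?T C) * (if C = min_elt ?T then X else 1))
      = (\<Sum>C\<in>insert (min_elt ?T) (atoms ?T).
           of_int (mobius ?T C) * (if C = min_elt ?T then X else 1))"
    using fin min_elt_in_Field[OF T] atoms_subset_Field[of ?T]
    by (intro sum.mono_neutral_right) (auto simp: mobius_rooted_tree[OF assms])
  also have "\<dots> = X + (\<Sum>C\<in>atoms ?T. of_int (mobius ?T C) * (if C = min_elt ?T then X else 1))"
    using fina min_elt_notin_atoms[of ?T] by (simp add: mobius_rooted_tree[OF assms])
  also have "\<dots> = X + (\<Sum>C\<in>atoms ?T. - 1)"
    using min_elt_notin_atoms[of ?T]
    by (intro arg_cong2[where f = "(+)"] sum.cong) (auto simp: mobius_rooted_tree[OF assms])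
  finally show ?thesis by simp
qed

section \<open>Products of rooted trees\<close>

lemma finite_poset_with_min_rooted_tree:
  assumes "finite_poset_with_min r" "S \<subseteq> Field r \<and> min_elt r \<in> S"
  shows "finite_poset_with_min (rooted_tree r S)"
  using rooted_tree_poset(1)[OF assms(1)] assms(2) by simp

lemma Field_tree_prod:
  assumes "finite_poset_with_min r" "\<And>i. i \<in> {1..n} \<Longrightarrow> S i \<subseteq> Field r \<and> min_elt r \<in> S i"
  shows "Field (tree_prod r n S) = (\<Pi>\<^sub>E i\<in>{1..n}. Field (rooted_tree r (S i)))"
  unfolding tree_prod_def using finite_poset_with_min_rooted_tree[OF assms]
  by (intro Field_prod_order) (simp add: finite_poset_with_min_def)

lemma finite_poset_with_min_tree_prod:
  assumes "finite_poset_with_min r" "\<And>i. i \<in> {1..n} \<Longrightarrow> S i \<subseteq> Field r \<and> min_elt r \<in> S i"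
  shows "finite_poset_with_min (tree_prod r n S)"
  unfolding tree_prod_def using finite_poset_with_min_rooted_tree[OF assms]
  by (intro prod_order_poset(1)) simp_all

lemma min_elt_tree_prod:
  assumes "finite_poset_with_min r" "\<And>i. i \<in> {1..n} \<Longrightarrow> S i \<subseteq> Field r \<and> min_elt r \<in> S i"
  shows "min_elt (tree_prod r n S) = (\<lambda>i\<in>{1..n}. min_elt (rooted_tree r (S i)))"
  unfolding tree_prod_def using finite_poset_with_min_rooted_tree[OF assms]
  by (intro prod_order_poset(2)) simp_all

lemma mobius_tree_prod_eq_prod:
  assumes "finite_poset_with_min r" "\<And>i. i \<in> {1..n} \<Longrightarrow> S i \<subseteq> Field r \<and> min_elt r \<in> S i"
    and "t \<in> Field (tree_prod r n S)"
  shows "mobius (tree_prod r n S) t = (\<Prod>i\<in>{1..n}. mobius (rooted_tree r (S i)) (t i))"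
  using assms(3) finite_poset_with_min_rooted_tree[OF assms(1,2)] unfolding tree_prod_def
  by (intro mobius_prod_order) simp_all

text \<open>One coordinate that is neither root nor atom annihilates the product of the tree values;
  otherwise each index of the support contributes -1 and every other index 1.\<close>

lemma mobius_tree_prod:
  assumes r: "finite_poset_with_min r"
    and S: "\<And>i. i \<in> {1..n} \<Longrightarrow> S i \<subseteq> Field r \<and> min_elt r \<in> S i"
    and t: "t \<in> Field (tree_prod r n S)"
  shows "mobius (tree_prod r n S) t = (if atomic r n S t then (- 1) ^ card (tsupp r n S t) else 0)"
proof -
  let ?T = "\<lambda>i. rooted_tree r (S i)"
  have eq: "mobius (tree_prod r n S) t = (\<Prod>i\<in>{1..n}. mobius (?T i) (t i))"
    using assms by (rule mobius_tree_prod_eq_prod)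
  have \<mu>: "mobius (?T i) C = (if C = min_elt (?T i) then 1 else if C \<in> atoms (?T i) then - 1 else 0)"
    if "i \<in> {1..n}" for i C
    using mobius_rooted_tree[OF r] S[OF that] by blast
  show ?thesis
  proof (cases "atomic r n S t")
    case True
    then have "(\<Prod>i\<in>{1..n}. mobius (?T i) (t i))
        = (\<Prod>i\<in>{1..n}. if i \<in> tsupp r n S t then - 1 else 1)"
      by (intro prod.cong) (auto simp: \<mu> atomic_def tsupp_def)
    also have "\<dots> = (\<Prod>i\<in>tsupp r n S t. - 1)"
      by (intro prod.mono_neutral_cong_right) (auto simp: tsupp_def)
    finally show ?thesis using True eq by simp
  next
    case False
    then obtain i where "i \<in> {1..n}" "t i \<noteq> min_elt (?T i)" "t i \<notin> atoms (?T i)"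
      unfolding atomic_def by blast
    then have "mobius (?T i) (t i) = 0" by (simp add: \<mu>)
    with \<open>i \<in> {1..n}\<close> have "(\<Prod>i\<in>{1..n}. mobius (?T i) (t i)) = 0"
      by (intro prod_zero) auto
    with False eq show ?thesis by simp
  qed
qed

text \<open>The weight \<open>X ^ (n - card (tsupp r n S t))\<close> splits over the coordinates as
  \<open>X\<close> at a root and 1 elsewhere, so the sum over the product set becomes a product of
  one-tree sums.\<close>

lemma sum_mobius_tree_prod:
  assumes r: "finite_poset_with_min r"
    and S: "\<And>i. i \<in> {1..n} \<Longrightarrow> S i \<subseteq> Field r \<and> min_elt r \<in> S i"
  shows "(\<Sum>t\<in>Field (tree_prod r n S).
            of_int (mobius (tree_prod r n S) t) * X ^ (n - card (tsupp r n S t)))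
         = (\<Prod>i\<in>{1..n}. (X :: 'b :: comm_ring_1) - of_nat (card (atoms (rooted_tree r (S i)))))"
proof -
  let ?T = "\<lambda>i. rooted_tree r (S i)"
  let ?w = "\<lambda>i C. of_int (mobius (?T i) C) * (if C = min_elt (?T i) then X else 1)"
  have T: "finite (Field (?T i))" if "i \<in> {1..n}" for i
    using finite_poset_with_min_rooted_tree[OF r S[OF that]] by (simp add: finite_poset_with_min_def)
  have F: "Field (tree_prod r n S) = (\<Pi>\<^sub>E i\<in>{1..n}. Field (?T i))"
    using r S by (rule Field_tree_prod)
  have "of_int (mobius (tree_prod r n S) t) * X ^ (n - card (tsupp r n S t))
      = (\<Prod>i\<in>{1..n}. ?w i (t i))" if t: "t \<in> Field (tree_prod r n S)" for t
  proof -
    have "mobius (tree_prod r n S) t = (\<Prod>i\<in>{1..n}. mobius (?T i) (t i))"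
      using r S t by (rule mobius_tree_prod_eq_prod)
    moreover have "(\<Prod>i\<in>{1..n}. if t i = min_elt (?T i) then X else 1)
        = X ^ (n - card (tsupp r n S t))"
    proof -
      have "{1..n} \<inter> {i. t i = min_elt (?T i)} = {1..n} - tsupp r n S t"
        by (auto simp: tsupp_def)
      moreover have "card ({1..n} - tsupp r n S t) = n - card (tsupp r n S t)"
        by (subst card_Diff_subset) (auto simp: tsupp_def)
      ultimately show ?thesis by (simp add: prod.If_cases)
    qed
    ultimately show ?thesis by (simp add: prod.distrib)
  qed
  then have "(\<Sum>t\<in>Field (tree_prod r n S).
       of_int (mobius (tree_prod r n S) t) * X ^ (n - card (tsupp r n S t)))
      = (\<Sum>t\<in>(\<Pi>\<^sub>E i\<in>{1..n}. Field (?T i)). \<Prod>i\<in>{1..n}. ?w i (t i))"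
    by (simp add: F)
  also have "\<dots> = (\<Prod>i\<in>{1..n}. \<Sum>C\<in>Field (?T i). ?w i C)"
    using T by (subst prod_sum_PiE) auto
  also have "\<dots> = (\<Prod>i\<in>{1..n}. X - of_nat (card (atoms (?T i))))"
    using S by (intro prod.cong refl sum_mobius_rooted_tree r) auto
  finally show ?thesis .
qed

section \<open>Fibres of a transversal function\<close>

text \<open>The isomorphism sends \<open>x\<close> to its fibre. Lifting makes it preserve the order
  and monotonicity of \<open>f\<close> makes it reflect the order; fibres over the carrier are
  nonempty by surjectivity, which gives injectivity.\<close>

lemma order_isomorphic_quotient_ker:
  assumes r: "finite_poset_with_min r" and surj: "f ` Field q = Field r"
    and mono: "\<And>s t. (s, t) \<in> q \<Longrightarrow> (f s, f t) \<in> r"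
    and lift: "\<And>x y s. (x, y) \<in> r \<Longrightarrow> s \<in> Field q \<Longrightarrow> f s = x \<Longrightarrow> \<exists>t\<in>Field q. f t = y \<and> (s, t) \<in> q"
  shows "order_isomorphic r (quotient_order q (ker_on (Field q) f))"
proof -
  let ?E = "ker_on (Field q) f"
  define \<phi> where "\<phi> = (\<lambda>x. {t \<in> Field q. f t = x})"
  have Image: "?E `` {t} = \<phi> (f t)" if "t \<in> Field q" for t
    using that by (auto simp add: ker_on_def \<phi>_def)
  have quot: "Field q // ?E = \<phi> ` Field r"
  proof -
    have "Field q // ?E = (\<Union>t\<in>Field q. {\<phi> (f t)})"
      unfolding quotient_def by (intro SUP_cong refl) (simp add: Image)
    then show ?thesis unfolding surj[symmetric] by blast
  qed
  have iff: "(x, y) \<in> r \<longleftrightarrow> (\<phi> x, \<phi> y) \<in> quotient_order q ?E"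
    if x: "x \<in> Field r" and y: "y \<in> Field r" for x y
  proof
    assume xy: "(x, y) \<in> r"
    obtain s where s: "s \<in> Field q" "f s = x"
      using x unfolding surj[symmetric] by blast
    from lift[OF xy s] obtain t where "t \<in> Field q" "f t = y" "(s, t) \<in> q" by blast
    with s x y show "(\<phi> x, \<phi> y) \<in> quotient_order q ?E"
      unfolding quotient_order_def quot by (auto simp: \<phi>_def)
  next
    assume "(\<phi> x, \<phi> y) \<in> quotient_order q ?E"
    then show "(x, y) \<in> r" using mono by (auto simp: quotient_order_def \<phi>_def)
  qed
  have "Field (quotient_order q ?E) = \<phi> ` Field r"
  proof
    show "Field (quotient_order q ?E) \<subseteq> \<phi> ` Field r"
      unfolding quot[symmetric] by (auto simp: quotient_order_def Field_def)
    show "\<phi> ` Field r \<subseteq> Field (quotient_order q ?E)"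
      using iff finite_poset_with_min_refl[OF r] by (auto intro: FieldI1)
  qed
  moreover have "inj_on \<phi> (Field r)"
  proof (rule inj_onI)
    fix x y assume x: "x \<in> Field r" and eq: "\<phi> x = \<phi> y"
    from x obtain s where "s \<in> Field q" "f s = x" unfolding surj[symmetric] by blast
    with eq show "x = y" unfolding \<phi>_def by blast
  qed
  ultimately show ?thesis
    unfolding order_isomorphic_def using iff by (intro exI[of _ \<phi>]) (auto simp: bij_betw_def)
qed

text \<open>The fibre sums satisfy the defining recursion of \<open>mobius r\<close>: adding them
  over all \<open>y\<close> below \<open>x\<close> sums \<open>mobius q\<close> over a lower ideal
  of \<open>q\<close>, and \<open>summation\<close> makes that sum vanish.\<close>

lemma mobius_eq_sum_fibre:
  assumes r: "finite_poset_with_min r" and q: "finite_poset_with_min q"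
    and surj: "f ` Field q = Field r"
    and mono: "\<And>s t. (s, t) \<in> q \<Longrightarrow> (f s, f t) \<in> r"
    and min: "\<And>t. t \<in> Field q \<Longrightarrow> f t = min_elt r \<Longrightarrow> t = min_elt q"
    and lift: "\<And>x y s. (x, y) \<in> r \<Longrightarrow> s \<in> Field q \<Longrightarrow> f s = x \<Longrightarrow> \<exists>t\<in>Field q. f t = y \<and> (s, t) \<in> q"
    and summation: "\<And>x. x \<in> Field r \<Longrightarrow> x \<noteq> min_elt r \<Longrightarrow>
          (\<Sum>s\<in>lower_ideal q {t \<in> Field q. f t = x}. mobius q s) = 0"
  shows "mobius r x = (\<Sum>t\<in>{t \<in> Field q. f t = x}. mobius q t)"
proof -
  define \<mu> where "\<mu> = (\<lambda>x. \<Sum>t\<in>{t \<in> Field q. f t = x}. mobius q t)"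
  have finq: "finite (Field q)" using q by (simp add: finite_poset_with_min_def)
  \<comment> \<open>Monotonicity gives one inclusion. For the other, lifting produces an element of
    the fibre over \<open>x\<close> above any \<open>s\<close> with \<open>f s\<close> below
    \<open>x\<close>.\<close>
  have ideal: "lower_ideal q {t \<in> Field q. f t = x} = {s \<in> Field q. (f s, x) \<in> r}" for x
    unfolding lower_ideal_def using mono lift by blast
  have sum: "(\<Sum>y\<in>under r x. \<mu> y) = (\<Sum>s\<in>lower_ideal q {t \<in> Field q. f t = x}. mobius q s)" for x
  proof -
    have "(\<Sum>s\<in>lower_ideal q {t \<in> Field q. f t = x}. mobius q s)
        = (\<Sum>y\<in>under r x. \<Sum>s\<in>{s \<in> {s \<in> Field q. (f s, x) \<in> r}. f s = y}. mobius q s)"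
      unfolding ideal using finq finite_under[OF r]
      by (intro sum.group[symmetric]) (auto simp: under_def)
    also have "\<dots> = (\<Sum>y\<in>under r x. \<mu> y)"
      unfolding \<mu>_def by (intro sum.cong) (auto simp: under_def)
    finally show ?thesis by simp
  qed
  \<comment> \<open>\<open>summation\<close> excludes the minimum; there the fibre is the single
    point \<open>min_elt q\<close>, where the Moebius value is 1.\<close>
  have "\<mu> (min_elt r) = 1"
  proof -
    obtain t where t: "t \<in> Field q" "f t = min_elt r"
      using min_elt_in_Field[OF r] unfolding surj[symmetric] by (metis imageE)
    have "{t \<in> Field q. f t = min_elt r} = {min_elt q}"
    proof (intro equalityI subsetI)
      show "s \<in> {min_elt q}" if "s \<in> {t \<in> Field q. f t = min_elt r}" for s
        using min[of s] that by simp
      show "s \<in> {t \<in> Field q. f t = min_elt r}" if "s \<in> {min_elt q}" for s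
        using min[OF t] t that by simp
    qed
    moreover have "mobius q (min_elt q) = 1"
      using is_mobius_mobius[OF q] min_elt_in_Field[OF q] under_min_elt[OF q]
      unfolding is_mobius_def by force
    ultimately show ?thesis by (simp add: \<mu>_def)
  qed
  then have "(\<Sum>y\<in>under r (min_elt r). \<mu> y) = 1" by (simp add: under_min_elt[OF r])
  moreover have "\<mu> x = 0" if "x \<notin> Field r" for x
  proof -
    have "{t \<in> Field q. f t = x} = {}" using that surj by auto
    then show ?thesis unfolding \<mu>_def by (simp only: sum.empty)
  qed
  ultimately have "is_mobius r \<mu>" using sum summation by (auto simp: is_mobius_def)
  from mobius_eqI[OF r this] show ?thesis by (simp add: \<mu>_def)
qed

section \<open>Rational functions\<close>

lemma ratfun_mult: "ratfun (p * q) = ratfun p * ratfun q"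
  by (simp add: ratfun_def)

lemma ratfun_power: "ratfun (p ^ k) = ratfun p ^ k"
  by (induction k) (simp_all add: ratfun_mult, simp add: ratfun_def One_fract_def)

lemma ratfun_prod: "ratfun (\<Prod>i\<in>I. g i) = (\<Prod>i\<in>I. ratfun (g i))"
  by (induction I rule: infinite_finite_induct)
    (simp_all add: ratfun_mult, simp_all add: ratfun_def One_fract_def)

lemma ratfun_eq_0_iff: "ratfun p = 0 \<longleftrightarrow> p = 0"
  by (simp add: ratfun_def Zero_fract_def eq_fract)

text \<open>Allows a power with possibly negative exponent to be handled by an identity between
  polynomials, cleared of denominators; division by \<open>ratfun p ^ n\<close> is legitimate
  because \<open>p\<close> is nonzero.\<close>

lemma ratfun_powi_mult_eq:
  assumes "p ^ n * c = p ^ m * d" and "p \<noteq> 0"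
  shows "ratfun c = ratfun p powi (int m - int n) * ratfun d"
proof -
  have "ratfun p ^ n * ratfun c = ratfun p ^ m * ratfun d"
    using assms(1) by (metis ratfun_mult ratfun_power)
  then show ?thesis using assms(2)
    by (simp add: power_int_diff ratfun_eq_0_iff field_simps)
qed

section \<open>Isomorphism, Moebius values and factorization of the characteristic
  polynomial\<close>

theorem theorem7:
  fixes r :: "'a rel" and \<rho> :: "'a \<Rightarrow> nat" and m n :: nat
    and S :: "nat \<Rightarrow> 'a set" and f :: "(nat \<Rightarrow> 'a set) \<Rightarrow> 'a"
  assumes poset: "finite_poset_with_min r"
    and m: "Max (\<rho> ` Field r) \<le> m"
    and S: "\<And>i. i \<in> {1..n} \<Longrightarrow> S i \<subseteq> Field r \<and> min_elt r \<in> S i"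
    and f: "transversal_function r n S f"
    and lift: "\<And>x y s. (x, y) \<in> r \<Longrightarrow> s \<in> transversals r n S f x \<Longrightarrow>
                 \<exists>t \<in> transversals r n S f y. (s, t) \<in> tree_prod r n S"
    and supp: "\<And>x t. x \<in> Field r \<Longrightarrow> t \<in> atomic_transversals r n S f x \<Longrightarrow>
                 card (tsupp r n S t) = \<rho> x"
    and summation: "\<And>x. x \<in> Field r \<Longrightarrow> x \<noteq> min_elt r \<Longrightarrow>
                 (\<Sum>s \<in> lower_ideal (tree_prod r n S) (transversals r n S f x).
                    mobius (tree_prod r n S) s) = 0"
  shows "order_isomorphic r
           (quotient_order (tree_prod r n S) (ker_on (Field (tree_prod r n S)) f)) \<and>
         (\<forall>x \<in> Field r.
           mobius r x = (-1) ^ \<rho> x * int (card (atomic_transversals r n S f x))) \<and>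
         ratfun (characteristic_poly r \<rho> m) =
           ratfun [:0, 1:] powi (int m - int n) *
           (\<Prod>i\<in>{1..n}. ratfun ([:0, 1:] - of_nat (card (atoms (rooted_tree r (S i))))))"
proof -
  let ?Q = "tree_prod r n S" and ?T = "\<lambda>i. rooted_tree r (S i)"
  let ?fib = "transversals r n S f" and ?X = "[:0, 1:] :: int poly"
  have Q: "finite_poset_with_min ?Q" using poset S by (rule finite_poset_with_min_tree_prod)
  have minQ: "min_elt ?Q = (\<lambda>i\<in>{1..n}. min_elt (?T i))" using poset S by (rule min_elt_tree_prod)
  have finr: "finite (Field r)" and finQ: "finite (Field ?Q)"
    using poset Q by (auto simp: finite_poset_with_min_def)
  from f have surj: "f ` Field ?Q = Field r"
    and mono: "\<And>s t. (s, t) \<in> ?Q \<Longrightarrow> (f s, f t) \<in> r"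
    and min: "\<And>t i. t \<in> Field ?Q \<Longrightarrow> f t = min_elt r \<Longrightarrow> i \<in> {1..n} \<Longrightarrow> t i = min_elt (?T i)"
    by (auto simp: transversal_function_def)
  have lift': "\<exists>t\<in>Field ?Q. f t = y \<and> (s, t) \<in> ?Q"
    if "(x, y) \<in> r" "s \<in> Field ?Q" "f s = x" for x y s
    using lift[OF that(1), of s] that by (auto simp: transversals_def)
  have min': "t = min_elt ?Q" if "t \<in> Field ?Q" "f t = min_elt r" for t
  proof -
    \<comment> \<open>The condition on \<open>f\<close> determines \<open>t\<close> only on
      \<open>{1..n}\<close>; extensionality fixes it elsewhere.\<close>
    have "t \<in> extensional {1..n}"
      using that(1) by (auto simp: tree_prod_def prod_order_def Field_def PiE_iff)
    then show ?thesis unfolding minQ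
      using min[OF that] by (intro extensionalityI[of _ "{1..n}"]) auto
  qed
  have \<mu>: "mobius r x = (\<Sum>t\<in>?fib x. mobius ?Q t)" for x
    unfolding transversals_def
    using poset Q surj mono min' lift' summation[unfolded transversals_def]
    by (rule mobius_eq_sum_fibre)
  have \<rho>: "card (tsupp r n S t) = \<rho> x" if "x \<in> Field r" "t \<in> ?fib x" "atomic r n S t" for x t
    using supp[OF that(1)] that(2,3) by (simp add: atomic_transversals_def)
  \<comment> \<open>By \<open>supp\<close> the sign is constant on the atomic part of a fibre, so a
    fibre sum merely counts atomic transversals.\<close>
  have \<mu>Q: "mobius ?Q t = (if atomic r n S t then (- 1) ^ \<rho> x else 0)"
    if "x \<in> Field r" "t \<in> ?fib x" for x t
    using that \<rho>[OF that] by (subst mobius_tree_prod[OF poset S]) (auto simp: transversals_def)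
  have finfib: "finite (?fib x)" for x using finQ by (simp add: transversals_def)

  have b: "mobius r x = (- 1) ^ \<rho> x * int (card (atomic_transversals r n S f x))"
    if x: "x \<in> Field r" for x
  proof -
    have "mobius r x = (\<Sum>t\<in>?fib x. if atomic r n S t then (- 1) ^ \<rho> x else 0)"
      unfolding \<mu> using \<mu>Q[OF x] by (intro sum.cong) auto
    also have "\<dots> = (\<Sum>t\<in>atomic_transversals r n S f x. (- 1) ^ \<rho> x)"
      unfolding atomic_transversals_def by (rule sum.inter_filter[OF finfib, symmetric])
    finally show ?thesis by simp
  qed

  \<comment> \<open>The factor \<open>?X ^ n\<close> clears the power with exponent
    \<open>m - n\<close>, which may be negative, and keeps the computation in the polynomial
    ring.\<close>
  have "?X ^ n * characteristic_poly r \<rho> m = (\<Sum>x\<in>Field r. \<Sum>t\<in>?fib x.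
      ?X ^ m * (of_int (mobius ?Q t) * ?X ^ (n - card (tsupp r n S t))))"
  proof -
    have "?X ^ n * monom (mobius r x) (m - \<rho> x) = (\<Sum>t\<in>?fib x.
        ?X ^ m * (of_int (mobius ?Q t) * ?X ^ (n - card (tsupp r n S t))))"
      if x: "x \<in> Field r" for x
    proof -
      have \<rho>m: "\<rho> x \<le> m" using m finr x by (meson Max_ge finite_imageI image_eqI le_trans)
      have "?X ^ n * monom (mobius r x) (m - \<rho> x) = of_int (mobius r x) * (?X ^ n * ?X ^ (m - \<rho> x))"
        by (simp add: monom_altdef of_int_poly)
      also have "\<dots> = (\<Sum>t\<in>?fib x. of_int (mobius ?Q t) * (?X ^ n * ?X ^ (m - \<rho> x)))"
        by (simp add: \<mu> sum_distrib_right)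
      also have "\<dots> = (\<Sum>t\<in>?fib x. ?X ^ m * (of_int (mobius ?Q t) * ?X ^ (n - card (tsupp r n S t))))"
      proof (intro sum.cong refl)
        fix t assume t: "t \<in> ?fib x"
        show "of_int (mobius ?Q t) * (?X ^ n * ?X ^ (m - \<rho> x))
            = ?X ^ m * (of_int (mobius ?Q t) * ?X ^ (n - card (tsupp r n S t)))"
        \<comment> \<open>For atomic \<open>t\<close> the support has size \<open>\<rho> x\<close>,
          so the exponents agree; the bounds by \<open>m\<close> and \<open>n\<close> keep both
          natural-number subtractions from truncating. For other \<open>t\<close> both sides are
          0.\<close>
        proof (cases "atomic r n S t")
          case True
          have "card (tsupp r n S t) \<le> card {1..n}"
            by (intro card_mono) (auto simp: tsupp_def)
          then have "n + (m - \<rho> x) = m + (n - card (tsupp r n S t))"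
            using \<rho>m \<rho>[OF x t True] by simp
          then have "?X ^ n * ?X ^ (m - \<rho> x) = ?X ^ m * ?X ^ (n - card (tsupp r n S t))"
            by (simp only: power_add[symmetric])
          then show ?thesis by (simp only: mult.left_commute)
        qed (simp add: \<mu>Q[OF x t])
      qed
      finally show ?thesis .
    qed
    then show ?thesis by (simp add: characteristic_poly_def sum_distrib_left)
  qed
  \<comment> \<open>The fibres over \<open>Field r\<close> partition the product, and the summand no
    longer mentions \<open>x\<close>.\<close>
  also have "\<dots> = (\<Sum>t\<in>Field ?Q. ?X ^ m * (of_int (mobius ?Q t) * ?X ^ (n - card (tsupp r n S t))))"
    unfolding transversals_def using finQ finr surj by (intro sum.group) auto
  also have "\<dots> = ?X ^ m * (\<Prod>i\<in>{1..n}. ?X - of_nat (card (atoms (?T i))))"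
    by (simp only: sum_distrib_left[symmetric] sum_mobius_tree_prod[OF poset S])
  finally have "ratfun (characteristic_poly r \<rho> m) = ratfun ?X powi (int m - int n) *
      ratfun (\<Prod>i\<in>{1..n}. ?X - of_nat (card (atoms (?T i))))"
    by (rule ratfun_powi_mult_eq) simp
  moreover have "order_isomorphic r (quotient_order ?Q (ker_on (Field ?Q) f))"
    using poset surj mono lift' by (rule order_isomorphic_quotient_ker)
  ultimately show ?thesis using b
    by (simp add: ratfun_prod)
qed

end
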